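(* Let $g:\mathbb{R}^n\to\mathbb{R}$ be continuously differentiable with $\|\nabla g(u)-\nabla g(v)\|\le L\|u-v\|$ for all $u,v\in\mathbb{R}^n$ for some constant $L>0$; let $h_1:\mathbb{R}^n\to\mathbb{R}\cup\{\infty\}$ be proper, lower semicontinuous and convex; let $h_2:\mathbb{R}^n\to\mathbb{R}$ be continuous and convex; and let $f=g+h_1-h_2$. Let $\{x_k\}_{k\ge0}$, $\{d_k\}_{k\ge0}$ be generated by the inexact proximal DC Newton-type method described in the context, where $B_0$ is symmetric positive definite and, for every $k\ge1$, $B_k$ is the memoryless matrix $$B_k=\tau_kI-\tau_k\frac{s_{k-1}s_{k-1}^T}{s_{k-1}^Ts_{k-1}}+\gamma_k\frac{z_{k-1}z_{k-1}^T}{s_{k-1}^Tz_{k-1}}+\tau_k\phi_kv_{k-1}v_{k-1}^T,$$ $$v_{k-1}=\sqrt{s_{k-1}^Ts_{k-1}}\left(\frac{z_{k-1}}{s_{k-1}^Tz_{k-1}}-\frac{s_{k-1}}{s_{k-1}^Ts_{k-1}}\right),$$ with $s_{k-1}=x_k-x_{k-1}$ and $z_{k-1}=\nabla g(x_k)-\nabla g(x_{k-1})+\nu_ks_{k-1}$. Assume $d_k\ne0$ for all $k$. Suppose there are constants $\underline\nu,\bar\nu>0$, $0\le\overline\phi_1<1$, $\overline\phi_2>0$, $0<\underline\gamma\le\overline\gamma$, $0<\underline\tau\le\overline\tau$ such that for all $k\ge1$: $$0\le\nu_k\le\bar\nu,\qquad s_{k-1}^Tz_{k-1}\ge\underline\nu\|s_{k-1}\|^2,$$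 $$\overline\phi_1\phi_k^\ast\le\phi_k\le\overline\phi_2,\qquad \underline\gamma\le\gamma_k\le\overline\gamma,\qquad \underline\tau\le\tau_k\le\overline\tau,$$ where $\phi_k^\ast=-\dfrac{(s_{k-1}^Tz_{k-1})^2}{(s_{k-1}^Ts_{k-1})(z_{k-1}^Tz_{k-1})-(s_{k-1}^Tz_{k-1})^2}$. If $f$ is bounded below, then $\lim_{k\to\infty}\|d_k\|=0$. Furthermore, if in addition $\{x_k\}$ is bounded, then every accumulation point $x^\ast$ of $\{x_k\}$ is a critical point, i.e. $0\in\nabla g(x^\ast)+\partial h_1(x^\ast)-\partial h_2(x^\ast)$.
   Context: Notation: $\|\cdot\|$ is the Euclidean norm, $\|x\|_A=\sqrt{x^TAx}$ for a symmetric positive definite matrix $A$, $\partial$ is the convex subdifferential, and the difference of sets is the Minkowski difference $\{a-b\}$. If $s_{k-1}$ and $z_{k-1}$ are parallel, the denominator of $\phi_k^\ast$ vanishes; in that case $v_{k-1}=0$ and the value of $\phi_k$ is irrelevant, so the condition $\overline\phi_1\phi_k^\ast\le\phi_k$ is regarded as void. Inexact proximal DC Newton-type method. Parameters: $x_0\in\mathrm{dom}(f)=\{x: f(x)<\infty\}$, $\delta\in(0,1)$, $\bar\theta\in(0,1]$, $0<\beta_{min}\le\beta_{max}<1$. For $k=0,1,2,\dots$: choose a symmetric positive definite matrix $B_k\in\mathbb{R}^{n\times n}$ and put $H_k=B_k^{-1}$; choose $\xi_k\in\partial h_2(x_k)$ and $\theta_k\in[\bar\theta,1]$; compute $x_k^+$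 and $r_k\in\mathbb{R}^n$ satisfying $$r_k\in\nabla g(x_k)-\xi_k+B_k(x_k^+-x_k)+\partial h_1(x_k^+),\qquad \|r_k\|_{H_k}\le(1-\theta_k)\|x_k^+-x_k\|_{B_k};$$ put $d_k=x_k^+-x_k$. Backtracking: start with $\rho=1$; while the condition $$f(x_k+\rho d_k)\le f(x_k)+\delta\rho\big((\nabla g(x_k)-\xi_k)^Td_k+h_1(x_k^+)-h_1(x_k)\big)$$ fails, choose some $\beta\in[\beta_{min},\beta_{max}]$ and replace $\rho$ by $\beta\rho$. Let $\eta_k$ be the final $\rho$ and set $x_{k+1}=x_k+\eta_kd_k$. (Under the stated conditions on the parameters, the matrices $B_k$ given by the formula are symmetric positive definite.) *)

theory Defs
  imports "HOL-Analysis.Analysis"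
begin

definition proper_fun :: "('a \<Rightarrow> ereal) \<Rightarrow> bool" where
  "proper_fun h \<longleftrightarrow> (\<forall>x. h x \<noteq> -\<infinity>) \<and> (\<exists>x. h x \<noteq> \<infinity>)"

definition lower_semicont :: "('a::topological_space \<Rightarrow> ereal) \<Rightarrow> bool" where
  "lower_semicont h \<longleftrightarrow> (\<forall>x. h x \<le> Liminf (at x) h)"

text \<open>The library predicate \<^const>\<open>convex_on\<close> is for real-valued functions only; for
  extended-valued functions convexity means convexity of the epigraph.\<close>

definition convex_ereal :: "('a::real_vector \<Rightarrow> ereal) \<Rightarrow> bool" where
  "convex_ereal h \<longleftrightarrow> convex {(x, t::real). h x \<le> ereal t}"

definition subdifferential :: "('a::real_inner \<Rightarrow> ereal) \<Rightarrow> 'a \<Rightarrow> 'a set" where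
  "subdifferential h x =
     {u. \<bar>h x\<bar> \<noteq> \<infinity> \<and> (\<forall>y. h x + ereal (u \<bullet> (y - x)) \<le> h y)}"

definition sym_pos_def :: "real^'n^'n \<Rightarrow> bool" where
  "sym_pos_def A \<longleftrightarrow> transpose A = A \<and> (\<forall>x. x \<noteq> 0 \<longrightarrow> x \<bullet> (A *v x) > 0)"

definition matrix_norm_vec :: "real^'n^'n \<Rightarrow> real^'n \<Rightarrow> real" where
  "matrix_norm_vec A x = sqrt (x \<bullet> (A *v x))"

definition outer :: "real^'n \<Rightarrow> real^'n \<Rightarrow> real^'n^'n" where
  "outer u v = (\<chi> i j. u $ i * v $ j)"

definition memoryless_v :: "real^'n \<Rightarrow> real^'n \<Rightarrow> real^'n" where
  "memoryless_v s z = sqrt (s \<bullet> s) *\<^sub>R ((1 / (s \<bullet> z)) *\<^sub>R z - (1 / (s \<bullet> s)) *\<^sub>R s)"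

definition memoryless_matrix ::
    "real \<Rightarrow> real \<Rightarrow> real \<Rightarrow> real^'n \<Rightarrow> real^'n \<Rightarrow> real^'n^'n" where
  "memoryless_matrix \<tau> \<gamma> \<phi> s z =
     \<tau> *\<^sub>R mat 1 - (\<tau> / (s \<bullet> s)) *\<^sub>R outer s s + (\<gamma> / (s \<bullet> z)) *\<^sub>R outer z z
     + (\<tau> * \<phi>) *\<^sub>R outer (memoryless_v s z) (memoryless_v s z)"

definition phi_denom :: "real^'n \<Rightarrow> real^'n \<Rightarrow> real" where
  "phi_denom s z = (s \<bullet> s) * (z \<bullet> z) - (s \<bullet> z)\<^sup>2"

text \<open>Meaningful only if \<^term>\<open>phi_denom s z \<noteq> 0\<close>, i.e. if \<open>s\<close> and \<open>z\<close> are not parallel.\<close>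

definition phi_star :: "real^'n \<Rightarrow> real^'n \<Rightarrow> real" where
  "phi_star s z = - ((s \<bullet> z)\<^sup>2 / phi_denom s z)"

definition dc_obj :: "('a \<Rightarrow> real) \<Rightarrow> ('a \<Rightarrow> ereal) \<Rightarrow> ('a \<Rightarrow> real) \<Rightarrow> 'a \<Rightarrow> ereal" where
  "dc_obj g h1 h2 x = ereal (g x) + h1 x - ereal (h2 x)"

text \<open>\<open>backtrack P b c \<rho> \<eta>\<close>: backtracking with acceptance test \<open>P\<close> and reduction factors
  chosen in \<open>[b, c]\<close>, started at \<open>\<rho>\<close>, can stop with \<open>\<eta>\<close>.\<close>

inductive backtrack :: "(real \<Rightarrow> bool) \<Rightarrow> real \<Rightarrow> real \<Rightarrow> real \<Rightarrow> real \<Rightarrow> bool"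
  for P b c where
  accept: "P \<rho> \<Longrightarrow> backtrack P b c \<rho> \<rho>"
| reduce: "\<not> P \<rho> \<Longrightarrow> b \<le> \<beta> \<Longrightarrow> \<beta> \<le> c \<Longrightarrow> backtrack P b c (\<beta> * \<rho>) \<eta> \<Longrightarrow> backtrack P b c \<rho> \<eta>"

text \<open>One iteration from \<open>x\<close> to \<open>x'\<close> with search direction \<open>d\<close>; \<open>G\<close> is the gradient of \<open>g\<close>.
  Positive definiteness of \<open>B\<close> is not part of this predicate: it is required of the initial
  matrix, and for the memoryless matrices it is a consequence of the parameter bounds rather
  than a hypothesis.\<close>

definition dc_newton_step ::
    "(real^'n \<Rightarrow> real) \<Rightarrow> (real^'n \<Rightarrow> real^'n) \<Rightarrow> (real^'n \<Rightarrow> ereal) \<Rightarrow> (real^'n \<Rightarrow> real)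
     \<Rightarrow> real \<Rightarrow> real \<Rightarrow> real \<Rightarrow> real \<Rightarrow> real^'n^'n \<Rightarrow> real^'n \<Rightarrow> real^'n \<Rightarrow> real^'n \<Rightarrow> bool" where
  "dc_newton_step g G h1 h2 \<delta> \<theta>bar \<beta>min \<beta>max B x d x' \<longleftrightarrow>
     (\<exists>\<xi> \<theta> xp r \<eta>.
        \<xi> \<in> subdifferential (\<lambda>y. ereal (h2 y)) x \<and>
        \<theta>bar \<le> \<theta> \<and> \<theta> \<le> 1 \<and>
        r \<in> {G x - \<xi> + B *v (xp - x) + u | u. u \<in> subdifferential h1 xp} \<and>
        matrix_norm_vec (matrix_inv B) r \<le> (1 - \<theta>) * matrix_norm_vec B (xp - x) \<and>
        d = xp - x \<and>
        backtrack
          (\<lambda>\<rho>. dc_obj g h1 h2 (x + \<rho> *\<^sub>R d)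
                \<le> dc_obj g h1 h2 x + ereal (\<delta> * \<rho>) * (ereal ((G x - \<xi>) \<bullet> d) + h1 xp - h1 x))
          \<beta>min \<beta>max 1 \<eta> \<and>
        x' = x + \<eta> *\<^sub>R d)"

definition dc_critical ::
    "('a::real_inner \<Rightarrow> 'a) \<Rightarrow> ('a \<Rightarrow> ereal) \<Rightarrow> ('a \<Rightarrow> real) \<Rightarrow> 'a \<Rightarrow> bool" where
  "dc_critical G h1 h2 x \<longleftrightarrow>
     0 \<in> {G x + a - b | a b. a \<in> subdifferential h1 x \<and> b \<in> subdifferential (\<lambda>y. ereal (h2 y)) x}"

end

theory Submission
  imports Defs
begin

text \<open>The parameter bounds make the matrices \<open>B\<^sub>k\<close> uniformly positive definite and bounded,
  \<open>m\<parallel>v\<parallel>\<^sup>2 \<le> v\<^sup>T B\<^sub>k v \<le> M\<parallel>v\<parallel>\<^sup>2\<close>, which is read off the quadratic form directly. The subgradient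
  inequality for \<open>h1\<close> at \<open>x\<^sub>k + d\<^sub>k\<close> and the residual bound show that the predicted change in the
  acceptance test is at most \<open>-\<theta> m\<parallel>d\<^sub>k\<parallel>\<^sup>2\<close>; with the Lipschitz gradient this keeps the accepted step
  sizes away from \<open>0\<close>. Hence \<open>f\<close> drops by a fixed multiple of \<open>\<parallel>d\<^sub>k\<parallel>\<^sup>2\<close> per iteration and
  \<open>d\<^sub>k \<longlonglongrightarrow> 0\<close>. Then also the residual \<open>r\<^sub>k\<close> and \<open>B\<^sub>k d\<^sub>k\<close> tend to \<open>0\<close>, and criticality of an
  accumulation point follows since the subgradients of \<open>h2\<close> stay bounded along a convergent
  subsequence and subdifferentials have closed graphs.\<close>

section \<open>Quadratic form of the memoryless matrix\<close>

lemma outer_mult_vec: "outer u w *v x = (w \<bullet> x) *\<^sub>R u"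
  by (simp add: vec_eq_iff outer_def matrix_vector_mult_def inner_vec_def sum_distrib_left mult_ac)

lemma transpose_memoryless_matrix:
  "transpose (memoryless_matrix \<tau> \<gamma> \<phi> s z) = memoryless_matrix \<tau> \<gamma> \<phi> s z"
  by (simp add: vec_eq_iff memoryless_matrix_def transpose_def outer_def mat_def mult_ac)

lemma memoryless_matrix_quadratic_form:
  "v \<bullet> (memoryless_matrix \<tau> \<gamma> \<phi> s z *v v) =
    \<tau> * (v \<bullet> v - (s \<bullet> v)\<^sup>2 / (s \<bullet> s)) + \<gamma> / (s \<bullet> z) * (z \<bullet> v)\<^sup>2
    + \<tau> * \<phi> * (memoryless_v s z \<bullet> v)\<^sup>2"
proof -
  have sc: "(c *\<^sub>R A) *v v = c *\<^sub>R (A *v v)" for c and A :: "real^'n^'n" and v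
    by (simp add: scaleR_matrix_vector_assoc)
  show ?thesis
    unfolding memoryless_matrix_def matrix_vector_mult_add_rdistrib matrix_vector_mult_diff_rdistrib
      sc outer_mult_vec matrix_vector_mul_lid
    by (simp add: inner_add_right inner_diff_right inner_commute power2_eq_square algebra_simps)
qed

lemma memoryless_v_orthogonal:
  assumes "s \<noteq> 0" "s \<bullet> z \<noteq> 0"
  shows "s \<bullet> memoryless_v s z = 0"
  using assms by (simp add: memoryless_v_def inner_diff_right)

text \<open>In the expanded square the mixed and the pure \<open>s\<close> terms add up to
  \<open>- 1 / (s \<bullet> s)\<close>. So \<open>phi_denom s z\<close> vanishes exactly when
  \<open>memoryless_v s z\<close> does, and otherwise \<open>phi_star s z\<close> is the negative
  reciprocal of the squared norm.\<close>

lemma memoryless_v_norm: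
  assumes "s \<noteq> 0" "s \<bullet> z \<noteq> 0"
  shows "memoryless_v s z \<bullet> memoryless_v s z = phi_denom s z / (s \<bullet> z)\<^sup>2"
proof -
  have a: "s \<bullet> s > 0" using assms by simp
  have "memoryless_v s z \<bullet> memoryless_v s z =
     (sqrt (s \<bullet> s))\<^sup>2 * (((1 / (s \<bullet> z)) *\<^sub>R z - (1 / (s \<bullet> s)) *\<^sub>R s) \<bullet>
        ((1 / (s \<bullet> z)) *\<^sub>R z - (1 / (s \<bullet> s)) *\<^sub>R s))"
    by (simp add: memoryless_v_def power2_eq_square mult.assoc)
  also have "\<dots> = (s \<bullet> s) * ((z \<bullet> z) / (s \<bullet> z)\<^sup>2 - 1 / (s \<bullet> s))"
    using a assms(2) by (simp add: inner_diff_left inner_diff_right inner_commute power2_eq_square field_simps)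
  also have "\<dots> = phi_denom s z / (s \<bullet> z)\<^sup>2"
    using a assms(2) by (simp add: phi_denom_def field_simps power2_eq_square)
  finally show ?thesis .
qed

text \<open>The numerator \<open>phi_denom s z\<close> is at most
  \<open>K\<^sup>2 * (s \<bullet> s)\<^sup>2\<close>, and the curvature condition makes the
  denominator at least \<open>\<nu>\<^sup>2 * (s \<bullet> s)\<^sup>2\<close>, so the length of
  \<open>s\<close> cancels.\<close>

lemma memoryless_v_norm_le:
  assumes "s \<noteq> 0" "\<nu> > 0" "s \<bullet> z \<ge> \<nu> * (norm s)\<^sup>2" "norm z \<le> K * norm s"
  shows "memoryless_v s z \<bullet> memoryless_v s z \<le> (K / \<nu>)\<^sup>2"
proof -
  have a: "s \<bullet> s > 0" using assms by simp
  have b: "s \<bullet> z \<ge> \<nu> * (s \<bullet> s)" using assms by (simp add: power2_norm_eq_inner)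
  then have b0: "s \<bullet> z > 0" using a assms(2) by (smt (verit) mult_pos_pos)
  have "z \<bullet> z \<le> (K * norm s)\<^sup>2"
    using power_mono[OF assms(4), of 2] by (simp add: power2_norm_eq_inner)
  then have c: "z \<bullet> z \<le> K\<^sup>2 * (s \<bullet> s)"
    by (simp add: power_mult_distrib power2_norm_eq_inner)
  have "phi_denom s z \<le> (s \<bullet> s) * (z \<bullet> z)" by (simp add: phi_denom_def)
  also have "\<dots> \<le> (s \<bullet> s) * (K\<^sup>2 * (s \<bullet> s))" using c a by (simp add: mult_left_mono)
  also have "\<dots> = (K / \<nu>)\<^sup>2 * (\<nu> * (s \<bullet> s))\<^sup>2"
    using assms(2) by (simp add: power2_eq_square field_simps)
  also have "\<dots> \<le> (K / \<nu>)\<^sup>2 * (s \<bullet> z)\<^sup>2"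
    using b a assms(2) by (intro mult_left_mono power_mono) auto
  finally show ?thesis
    using memoryless_v_norm[of s z] assms(1) b0 by (simp add: pos_divide_le_eq)
qed

text \<open>The three summands of the quadratic form are bounded one by one: the projection by the
  identity, the two rank-one terms by Cauchy-Schwarz. The length of \<open>s\<close> cancels in
  each, which makes the bound uniform over the iterations.\<close>

lemma memoryless_matrix_upper:
  assumes "s \<noteq> 0" "\<nu> > 0" and sz: "s \<bullet> z \<ge> \<nu> * (norm s)\<^sup>2" and z: "norm z \<le> K * norm s"
    and "0 \<le> \<gamma>" "\<gamma> \<le> \<gamma>hi" "0 \<le> \<tau>" "\<tau> \<le> \<tau>hi" "\<phi> \<le> \<phi>hi" "0 \<le> \<phi>hi"
  shows "v \<bullet> (memoryless_matrix \<tau> \<gamma> \<phi> s z *v v)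
    \<le> (\<tau>hi + \<gamma>hi * K\<^sup>2 / \<nu> + \<tau>hi * \<phi>hi * (K / \<nu>)\<^sup>2) * (norm v)\<^sup>2"
proof -
  have a: "s \<bullet> s > 0" using assms by simp
  have b: "s \<bullet> z \<ge> \<nu> * (s \<bullet> s)" using assms by (simp add: power2_norm_eq_inner)
  then have b0: "s \<bullet> z > 0" using a assms(2) by (smt (verit) mult_pos_pos)
  have t1: "\<tau> * (v \<bullet> v - (s \<bullet> v)\<^sup>2 / (s \<bullet> s)) \<le> \<tau>hi * (norm v)\<^sup>2"
  proof -
    have "\<tau> * (v \<bullet> v - (s \<bullet> v)\<^sup>2 / (s \<bullet> s)) \<le> \<tau> * (v \<bullet> v)"
      using a assms(7) by (intro mult_left_mono) auto
    also have "\<dots> \<le> \<tau>hi * (v \<bullet> v)" using assms(8) by (simp add: mult_right_mono)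
    finally show ?thesis by (simp add: power2_norm_eq_inner)
  qed
  have t2: "\<gamma> / (s \<bullet> z) * (z \<bullet> v)\<^sup>2 \<le> \<gamma>hi * K\<^sup>2 / \<nu> * (norm v)\<^sup>2"
  proof -
    have "(z \<bullet> v)\<^sup>2 \<le> (norm z)\<^sup>2 * (norm v)\<^sup>2"
      by (simp add: Cauchy_Schwarz_ineq power2_norm_eq_inner)
    also have "\<dots> \<le> (K * norm s)\<^sup>2 * (norm v)\<^sup>2"
      using z by (intro mult_right_mono power_mono) auto
    finally have "(z \<bullet> v)\<^sup>2 \<le> K\<^sup>2 * (s \<bullet> s) * (norm v)\<^sup>2"
      by (simp add: power_mult_distrib power2_norm_eq_inner)
    moreover have "\<gamma> / (s \<bullet> z) \<le> \<gamma>hi / (\<nu> * (s \<bullet> s))"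
      using assms a b by (intro frac_le) auto
    moreover have "0 \<le> \<gamma>hi / (\<nu> * (s \<bullet> s))" using assms a by auto
    ultimately have "\<gamma> / (s \<bullet> z) * (z \<bullet> v)\<^sup>2 \<le> \<gamma>hi / (\<nu> * (s \<bullet> s)) * (K\<^sup>2 * (s \<bullet> s) * (norm v)\<^sup>2)"
      by (intro mult_mono) auto
    also have "\<dots> = \<gamma>hi * K\<^sup>2 / \<nu> * (norm v)\<^sup>2" using a assms(2) by (simp add: field_simps)
    finally show ?thesis .
  qed
  have t3: "\<tau> * \<phi> * (memoryless_v s z \<bullet> v)\<^sup>2 \<le> \<tau>hi * \<phi>hi * (K / \<nu>)\<^sup>2 * (norm v)\<^sup>2"
  proof -
    have "(memoryless_v s z \<bullet> v)\<^sup>2 \<le> (memoryless_v s z \<bullet> memoryless_v s z) * (v \<bullet> v)"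
      by (rule Cauchy_Schwarz_ineq)
    also have "\<dots> \<le> (K / \<nu>)\<^sup>2 * (v \<bullet> v)"
      using memoryless_v_norm_le[OF assms(1,2) sz z] by (intro mult_right_mono) auto
    finally have w: "(memoryless_v s z \<bullet> v)\<^sup>2 \<le> (K / \<nu>)\<^sup>2 * (norm v)\<^sup>2"
      by (simp add: power2_norm_eq_inner)
    \<comment> \<open>As \<open>\<phi>\<close> may be negative, it is replaced first, using
      \<open>0 \<le> \<tau>\<close>; only then is \<open>\<tau>\<close> enlarged, using
      \<open>0 \<le> \<phi>hi\<close>.\<close>
    have "\<tau> * \<phi> \<le> \<tau> * \<phi>hi" using assms by (simp add: mult_left_mono)
    also have "\<dots> \<le> \<tau>hi * \<phi>hi" using assms by (simp add: mult_right_mono)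
    finally have "\<tau> * \<phi> * (memoryless_v s z \<bullet> v)\<^sup>2 \<le> \<tau>hi * \<phi>hi * (memoryless_v s z \<bullet> v)\<^sup>2"
      by (simp add: mult_right_mono)
    also have "\<dots> \<le> \<tau>hi * \<phi>hi * ((K / \<nu>)\<^sup>2 * (norm v)\<^sup>2)"
      using w assms by (intro mult_left_mono) auto
    finally show ?thesis by (simp add: mult.assoc)
  qed
  show ?thesis
    unfolding memoryless_matrix_quadratic_form using t1 t2 t3 by (simp add: distrib_right)
qed

text \<open>Since \<open>\<phi>\<^sup>* = -1 / \<parallel>w\<parallel>\<^sup>2\<close> for \<open>w = memoryless_v s z\<close>, and \<open>w\<close> is orthogonal to \<open>s\<close>, a negative
  \<open>\<phi>\<close> destroys at most the fraction \<open>\<phi>1\<close> of the form \<open>\<tau>\<parallel>p\<parallel>\<^sup>2\<close>, where \<open>p\<close> is the component of \<open>v\<close>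
  orthogonal to \<open>s\<close>. The component along \<open>s\<close> is controlled by \<open>(z \<bullet> v)\<^sup>2\<close>, because \<open>z\<close> is a
  multiple of \<open>s / \<parallel>s\<parallel> + w\<close>.\<close>

lemma memoryless_matrix_lower:
  assumes "s \<noteq> 0" "\<nu> > 0" and sz: "s \<bullet> z \<ge> \<nu> * (norm s)\<^sup>2" and z: "norm z \<le> K * norm s"
    and "0 < \<gamma>lo" "\<gamma>lo \<le> \<gamma>" "0 < \<tau>lo" "\<tau>lo \<le> \<tau>"
    and \<phi>1: "0 \<le> \<phi>1" "\<phi>1 < 1" and \<phi>: "phi_denom s z \<noteq> 0 \<Longrightarrow> \<phi>1 * phi_star s z \<le> \<phi>"
  shows "(norm v)\<^sup>2 \<le> (2 / (\<gamma>lo * \<nu>) + (2 * (K / \<nu>)\<^sup>2 + 1) / (\<tau>lo * (1 - \<phi>1)))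
     * (v \<bullet> (memoryless_matrix \<tau> \<gamma> \<phi> s z *v v))"
proof -
  define a where "a = s \<bullet> s"
  define b where "b = s \<bullet> z"
  define w where "w = memoryless_v s z"
  \<comment> \<open>\<open>\<alpha>\<close> is the coordinate of \<open>v\<close> along the unit
    vector of \<open>s\<close>, and \<open>q\<close> is \<open>z \<bullet> v\<close> up to the
    factor \<open>b / sqrt a\<close>. The form controls \<open>p\<close> and \<open>q\<close>, and
    \<open>\<alpha>\<close> is recovered as \<open>q - w \<bullet> p\<close>.\<close>
  define \<alpha> where "\<alpha> = (s \<bullet> v) / sqrt a"
  define p where "p = v - (\<alpha> / sqrt a) *\<^sub>R s"
  define q where "q = \<alpha> + w \<bullet> p"
  have a: "a > 0" using assms by (simp add: a_def)
  have b: "b \<ge> \<nu> * a" using sz by (simp add: power2_norm_eq_inner a_def b_def)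
  then have b0: "b > 0" using a assms(2) by (smt (verit) mult_pos_pos)
  have sa: "sqrt a * sqrt a = a" "sqrt a > 0" using a by auto
  have ws: "s \<bullet> w = 0"
    unfolding w_def using assms(1) b0 by (intro memoryless_v_orthogonal) (auto simp: b_def)
  have sp: "s \<bullet> p = 0"
    using sa a by (simp add: p_def \<alpha>_def inner_diff_right flip: a_def)
  have v: "v = (\<alpha> / sqrt a) *\<^sub>R s + p" by (simp add: p_def)
  have vv: "v \<bullet> v = \<alpha>\<^sup>2 + p \<bullet> p"
  proof -
    have "v \<bullet> v = (\<alpha> / sqrt a)\<^sup>2 * a + p \<bullet> p"
      by (subst (1 2) v) (simp add: inner_add_left inner_add_right sp inner_commute[of p s]
          power2_eq_square flip: a_def)
    then show ?thesis using a by (simp add: power_divide)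
  qed
  have pp: "v \<bullet> v - (s \<bullet> v)\<^sup>2 / a = p \<bullet> p"
    using vv a by (simp add: \<alpha>_def power_divide)
  have wv: "w \<bullet> v = w \<bullet> p"
    by (subst v) (simp add: inner_add_right inner_commute[of w s] ws)
  have zdec: "z = (b / sqrt a) *\<^sub>R ((1 / sqrt a) *\<^sub>R s + w)"
  proof -
    have "w = (sqrt a / b) *\<^sub>R z - (1 / sqrt a) *\<^sub>R s"
      using sa a by (simp add: w_def memoryless_v_def scaleR_diff_right field_simps flip: a_def b_def)
    then show ?thesis using sa(2) b0 by simp
  qed
  have "z \<bullet> v = (b / sqrt a) * ((1 / sqrt a) * (s \<bullet> v) + w \<bullet> v)"
    by (subst zdec) (simp add: inner_add_left)
  then have zv: "z \<bullet> v = (b / sqrt a) * q" by (simp add: q_def \<alpha>_def wv)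
  have t2: "\<gamma> / b * (z \<bullet> v)\<^sup>2 \<ge> \<gamma>lo * \<nu> * q\<^sup>2"
  proof -
    have "\<gamma> / b * (z \<bullet> v)\<^sup>2 = \<gamma> * (b / a) * q\<^sup>2"
      using b0 a by (simp add: zv power_mult_distrib power_divide) (simp add: power2_eq_square)
    moreover have "\<nu> \<le> b / a" using b a by (simp add: pos_le_divide_eq)
    then have "\<gamma>lo * \<nu> \<le> \<gamma> * (b / a)" using assms by (intro mult_mono) auto
    then have "\<gamma>lo * \<nu> * q\<^sup>2 \<le> \<gamma> * (b / a) * q\<^sup>2" by (rule mult_right_mono) simp
    ultimately show ?thesis by (simp only:)
  qed
  have wp: "(w \<bullet> p)\<^sup>2 \<le> (w \<bullet> w) * (p \<bullet> p)" by (rule Cauchy_Schwarz_ineq)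
  have ww: "w \<bullet> w = phi_denom s z / b\<^sup>2"
    unfolding w_def b_def using assms(1) b0 by (intro memoryless_v_norm) (auto simp: b_def)
  have t3: "\<phi> * (w \<bullet> v)\<^sup>2 \<ge> - \<phi>1 * (p \<bullet> p)"
  \<comment> \<open>In the degenerate case \<open>w = 0\<close>, so the term vanishes whatever
    \<open>\<phi>\<close> is. In the other case with \<open>\<phi> < 0\<close>, Cauchy-Schwarz is
    multiplied by a negative number, which turns it into a lower bound.\<close>
  proof (cases "phi_denom s z = 0 \<or> \<phi> \<ge> 0")
    case True
    then have "\<phi> * (w \<bullet> v)\<^sup>2 \<ge> 0" using ww by auto
    then show ?thesis using \<phi>1 by (smt (verit) inner_ge_zero mult_minus_left mult_nonneg_nonneg)
  next
    case False
    then have "phi_star s z = - 1 / (w \<bullet> w)" by (simp add: phi_star_def ww b_def)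
    moreover have w0: "w \<bullet> w > 0" using False ww b0 by (metis divide_eq_0_iff inner_gt_zero_iff
          inner_zero_left order_less_irrefl zero_eq_power2)
    ultimately have "- \<phi>1 \<le> \<phi> * (w \<bullet> w)" using \<phi> False by (simp add: field_simps)
    then have "- \<phi>1 * (p \<bullet> p) \<le> \<phi> * (w \<bullet> w) * (p \<bullet> p)" by (intro mult_right_mono) auto
    also have "\<dots> \<le> \<phi> * (w \<bullet> p)\<^sup>2" using wp False by (simp add: mult.assoc mult_left_mono_neg)
    finally show ?thesis by (simp add: wv)
  qed
  have "\<tau> * (p \<bullet> p) + \<tau> * (\<phi> * (w \<bullet> v)\<^sup>2) \<ge> \<tau> * (p \<bullet> p) + \<tau> * (- \<phi>1 * (p \<bullet> p))"
    using t3 assms by (intro add_left_mono mult_left_mono) auto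
  moreover have "\<tau> * (p \<bullet> p) + \<tau> * (- \<phi>1 * (p \<bullet> p)) = \<tau> * ((1 - \<phi>1) * (p \<bullet> p))"
    by (simp add: algebra_simps)
  moreover have "\<tau> * ((1 - \<phi>1) * (p \<bullet> p)) \<ge> \<tau>lo * ((1 - \<phi>1) * (p \<bullet> p))"
    using assms by (intro mult_right_mono) auto
  ultimately have t13: "\<tau> * (p \<bullet> p) + \<tau> * \<phi> * (w \<bullet> v)\<^sup>2 \<ge> \<tau>lo * (1 - \<phi>1) * (p \<bullet> p)"
    by (simp add: mult.assoc)
  define c1 where "c1 = \<tau>lo * (1 - \<phi>1)"
  define c2 where "c2 = \<gamma>lo * \<nu>"
  define W where "W = (K / \<nu>)\<^sup>2"
  have c: "c1 > 0" "c2 > 0" "W \<ge> 0" using assms by (auto simp: c1_def c2_def W_def)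
  define Q where "Q = v \<bullet> (memoryless_matrix \<tau> \<gamma> \<phi> s z *v v)"
  have Q: "Q \<ge> c1 * (p \<bullet> p) + c2 * q\<^sup>2"
    unfolding Q_def memoryless_matrix_quadratic_form using t13 t2
    by (simp add: pp c1_def c2_def flip: a_def b_def w_def)
  have "w \<bullet> w \<le> W" unfolding W_def w_def using assms by (intro memoryless_v_norm_le)
  then have wpW: "(w \<bullet> p)\<^sup>2 \<le> W * (p \<bullet> p)" using wp by (meson inner_ge_zero mult_right_mono order_trans)
  have "\<alpha>\<^sup>2 \<le> 2 * q\<^sup>2 + 2 * (w \<bullet> p)\<^sup>2"
  proof -
    have "2 * q\<^sup>2 + 2 * (w \<bullet> p)\<^sup>2 - \<alpha>\<^sup>2 = (q + w \<bullet> p)\<^sup>2"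
      by (simp add: q_def power2_eq_square algebra_simps)
    then show ?thesis by (smt (verit) zero_le_power2)
  qed
  then have "v \<bullet> v \<le> 2 * q\<^sup>2 + (2 * W + 1) * (p \<bullet> p)"
    using vv wpW by (simp add: algebra_simps)
  also have "\<dots> = 2 / c2 * (c2 * q\<^sup>2) + (2 * W + 1) / c1 * (c1 * (p \<bullet> p))"
    using c by simp
  also have "\<dots> \<le> 2 / c2 * Q + (2 * W + 1) / c1 * Q"
  proof (intro add_mono mult_left_mono)
    have n: "c1 * (p \<bullet> p) \<ge> 0" "c2 * q\<^sup>2 \<ge> 0" using c by auto
    show "c2 * q\<^sup>2 \<le> Q" "c1 * (p \<bullet> p) \<le> Q" using Q n by linarith+
  qed (use c in auto)
  finally show ?thesis
    unfolding c1_def[symmetric] c2_def[symmetric] W_def[symmetric] Q_def[symmetric]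
    by (simp add: power2_norm_eq_inner distrib_right)
qed

section \<open>Symmetric matrices with two-sided quadratic bounds\<close>

lemma sym_matrix_inner_commute:
  fixes A :: "real^'n^'n"
  assumes "transpose A = A"
  shows "x \<bullet> (A *v y) = y \<bullet> (A *v x)"
  by (metis assms dot_lmul_matrix inner_commute transpose_matrix_vector)

text \<open>The form is nonnegative at \<open>x - t *\<^sub>R y\<close>; the \<open>t\<close> chosen
  below minimizes it.\<close>

lemma sym_matrix_Cauchy_Schwarz:
  fixes A :: "real^'n^'n"
  assumes sym: "transpose A = A" and pos: "\<And>v. v \<bullet> (A *v v) \<ge> 0"
    and y: "y \<bullet> (A *v y) > 0"
  shows "(x \<bullet> (A *v y))\<^sup>2 \<le> (x \<bullet> (A *v x)) * (y \<bullet> (A *v y))"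
proof -
  define t where "t = (x \<bullet> (A *v y)) / (y \<bullet> (A *v y))"
  have "0 \<le> (x - t *\<^sub>R y) \<bullet> (A *v (x - t *\<^sub>R y))" by (rule pos)
  also have "\<dots> = x \<bullet> (A *v x) - 2 * t * (x \<bullet> (A *v y)) + t\<^sup>2 * (y \<bullet> (A *v y))"
    using sym_matrix_inner_commute[OF sym, of x y]
    by (simp add: matrix_vector_mult_diff_distrib matrix_vector_mult_scaleR inner_diff_left
        inner_diff_right power2_eq_square algebra_simps)
  also have "\<dots> = x \<bullet> (A *v x) - (x \<bullet> (A *v y))\<^sup>2 / (y \<bullet> (A *v y))"
    using y by (simp add: t_def power2_eq_square field_simps)
  finally show ?thesis using y by (simp add: pos_divide_le_eq)
qed

text \<open>This says that all eigenvalues of the symmetric matrix lie between \<open>m\<close> and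
  \<open>M\<close>, in a form that avoids spectral theory.\<close>

definition quad_bounds :: "real \<Rightarrow> real \<Rightarrow> real^'n^'n \<Rightarrow> bool" where
  "quad_bounds m M A \<longleftrightarrow> transpose A = A \<and>
     (\<forall>v. m * (norm v)\<^sup>2 \<le> v \<bullet> (A *v v) \<and> v \<bullet> (A *v v) \<le> M * (norm v)\<^sup>2)"

lemma quad_bounds_mono:
  assumes "quad_bounds m M A" "m' \<le> m" "M \<le> M'"
  shows "quad_bounds m' M' A"
  using assms unfolding quad_bounds_def
  by (meson mult_right_mono order_trans zero_le_power2)

lemma quad_bounds_pos:
  assumes "quad_bounds m M A" "m > 0" "v \<noteq> 0"
  shows "v \<bullet> (A *v v) > 0"
  using assms unfolding quad_bounds_def
  by (smt (verit) mult_pos_pos zero_less_norm_iff zero_less_power)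

lemma quad_bounds_Cauchy_Schwarz:
  assumes "quad_bounds m M A" "m > 0"
  shows "(x \<bullet> (A *v y))\<^sup>2 \<le> (x \<bullet> (A *v x)) * (y \<bullet> (A *v y))"
proof (cases "y = 0")
  case False
  have "v \<bullet> (A *v v) \<ge> 0" for v
    using quad_bounds_pos[OF assms, of v] by (cases "v = 0") auto
  then show ?thesis
    using quad_bounds_pos[OF assms False] assms(1) unfolding quad_bounds_def
    by (intro sym_matrix_Cauchy_Schwarz) auto
qed simp

text \<open>This is \<open>A\<^sup>2 \<le> M A\<close> as an inequality of forms. With
  \<open>y = A *v x\<close>, Cauchy-Schwarz for the form of \<open>A\<close> bounds the fourth power
  of \<open>norm y\<close> by \<open>M * (norm y)\<^sup>2 * (x \<bullet> (A *v x))\<close>, and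
  \<open>(norm y)\<^sup>2\<close> cancels.\<close>

lemma quad_bounds_norm_mult_sq:
  assumes "quad_bounds m M A" "m > 0"
  shows "(norm (A *v x))\<^sup>2 \<le> M * (x \<bullet> (A *v x))"
proof (cases "A *v x = 0")
  case False
  define y where "y = A *v x"
  have sym: "transpose A = A" using assms by (simp add: quad_bounds_def)
  have xx: "x \<bullet> (A *v x) \<ge> 0"
    using quad_bounds_pos[OF assms, of x] by (cases "x = 0") auto
  have "((norm y)\<^sup>2)\<^sup>2 = (y \<bullet> (A *v x))\<^sup>2" by (simp add: y_def power2_norm_eq_inner)
  also have "\<dots> \<le> (y \<bullet> (A *v y)) * (x \<bullet> (A *v x))" by (rule quad_bounds_Cauchy_Schwarz[OF assms])
  also have "\<dots> \<le> (M * (norm y)\<^sup>2) * (x \<bullet> (A *v x))"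
    using assms xx by (intro mult_right_mono) (auto simp: quad_bounds_def)
  finally have "(norm y)\<^sup>2 * (norm y)\<^sup>2 \<le> (norm y)\<^sup>2 * (M * (x \<bullet> (A *v x)))"
    by (simp only: power2_eq_square[of "(norm y)\<^sup>2"] mult_ac)
  moreover have "(norm y)\<^sup>2 > 0" using False by (simp add: y_def)
  ultimately show ?thesis unfolding y_def by (rule mult_left_le_imp_le)
qed (use quad_bounds_pos[OF assms, of x] in auto)

lemma quad_bounds_upper_nonneg:
  assumes "quad_bounds m M (A :: real^'n^'n)" "m > 0"
  shows "M \<ge> 0"
proof -
  obtain v :: "real^'n" where "norm v = 1" using vector_choose_size[of 1] by auto
  then have "m \<le> v \<bullet> (A *v v)" "v \<bullet> (A *v v) \<le> M"
    using assms by (auto simp: quad_bounds_def dest!: spec[of _ v])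
  then show ?thesis using assms(2) by linarith
qed

lemma quad_bounds_norm_mult:
  assumes "quad_bounds m M A" "m > 0"
  shows "norm (A *v x) \<le> M * norm x"
proof (rule power2_le_imp_le)
  have "(norm (A *v x))\<^sup>2 \<le> M * (x \<bullet> (A *v x))" by (rule quad_bounds_norm_mult_sq[OF assms])
  also have "\<dots> \<le> M * (M * (norm x)\<^sup>2)"
    using assms quad_bounds_upper_nonneg[OF assms] by (intro mult_left_mono) (auto simp: quad_bounds_def)
  finally show "(norm (A *v x))\<^sup>2 \<le> (M * norm x)\<^sup>2"
    by (simp add: power2_eq_square mult_ac)
qed (use quad_bounds_upper_nonneg[OF assms] in auto)

lemma quad_bounds_invertible:
  fixes A :: "real^'n^'n"
  assumes "quad_bounds m M A" "m > 0"
  shows "invertible A"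
proof -
  have "x = 0" if "A *v x = 0" for x
    using quad_bounds_pos[OF assms, of x] that by auto
  then show ?thesis
    by (simp add: invertible_left_inverse matrix_left_invertible_ker)
qed

text \<open>Writing \<open>r = A *v q\<close> turns the norm of \<open>r\<close> weighted by the
  inverse into the \<open>A\<close>-norm of \<open>q\<close>. Cauchy-Schwarz for the form of
  \<open>A\<close> then gives the first bound, and \<open>quad_bounds_norm_mult_sq\<close> at
  \<open>q\<close> the second.\<close>

lemma quad_bounds_residual:
  fixes A :: "real^'n^'n"
  assumes A: "quad_bounds m M A" "m > 0"
    and r: "matrix_norm_vec (matrix_inv A) r \<le> c * matrix_norm_vec A d" and c: "0 \<le> c" "c \<le> 1"
  shows "r \<bullet> d \<le> c * (d \<bullet> (A *v d))" "norm r \<le> M * norm d"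
proof -
  define q where "q = matrix_inv A *v r"
  have rq: "r = A *v q"
  proof -
    have "A ** matrix_inv A = mat 1"
      using someI_ex[OF quad_bounds_invertible[OF A, unfolded invertible_def]]
      unfolding matrix_inv_def by blast
    then show ?thesis by (simp add: q_def matrix_vector_mul_assoc)
  qed
  have nn: "v \<bullet> (A *v v) \<ge> 0" for v
    using quad_bounds_pos[OF A, of v] by (cases "v = 0") auto
  have q: "sqrt (q \<bullet> (A *v q)) \<le> c * sqrt (d \<bullet> (A *v d))"
    using r unfolding matrix_norm_vec_def q_def[symmetric] by (simp add: rq inner_commute)
  have "\<bar>d \<bullet> (A *v q)\<bar> = sqrt ((d \<bullet> (A *v q))\<^sup>2)" by simp
  also have "\<dots> \<le> sqrt (d \<bullet> (A *v d)) * sqrt (q \<bullet> (A *v q))"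
    unfolding real_sqrt_mult[symmetric] by (intro real_sqrt_le_mono quad_bounds_Cauchy_Schwarz[OF A])
  also have "\<dots> \<le> sqrt (d \<bullet> (A *v d)) * (c * sqrt (d \<bullet> (A *v d)))"
    using q nn by (intro mult_left_mono) auto
  also have "\<dots> = c * (d \<bullet> (A *v d))" using nn[of d] by (simp add: mult.left_commute)
  finally show "r \<bullet> d \<le> c * (d \<bullet> (A *v d))" by (simp add: rq inner_commute)
  have "sqrt (q \<bullet> (A *v q)) \<le> sqrt (d \<bullet> (A *v d))"
    using q c nn[of d] by (smt (verit) mult_left_le_one_le real_sqrt_ge_zero)
  then have "q \<bullet> (A *v q) \<le> d \<bullet> (A *v d)" by simp
  also have "\<dots> \<le> M * (norm d)\<^sup>2" using A by (simp add: quad_bounds_def)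
  finally have "M * (q \<bullet> (A *v q)) \<le> M * (M * (norm d)\<^sup>2)"
    by (rule mult_left_mono) (rule quad_bounds_upper_nonneg[OF A])
  then have "(norm r)\<^sup>2 \<le> (M * norm d)\<^sup>2"
    using quad_bounds_norm_mult_sq[OF A, of q] by (simp add: rq power2_eq_square mult_ac)
  then show "norm r \<le> M * norm d"
    using quad_bounds_upper_nonneg[OF A] by (auto intro: power2_le_imp_le)
qed

text \<open>The bounds are the extreme values of the form on the compact unit sphere, carried over
  to all vectors by homogeneity of degree two.\<close>

lemma sym_pos_def_quad_bounds:
  fixes A :: "real^'n^'n"
  assumes "sym_pos_def A"
  obtains m M where "m > 0" "quad_bounds m M A"
proof -
  let ?S = "sphere (0 :: real^'n) 1"
  let ?f = "\<lambda>v. v \<bullet> (A *v v)"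
  have S: "compact ?S" "?S \<noteq> {}" by auto
  have cont: "continuous_on ?S ?f"
    by (intro continuous_on_inner continuous_on_id linear_continuous_on matrix_vector_mul_bounded_linear)
  obtain a where a: "a \<in> ?S" "\<And>v. v \<in> ?S \<Longrightarrow> ?f a \<le> ?f v"
    using continuous_attains_inf[OF S cont] by blast
  obtain b where b: "b \<in> ?S" "\<And>v. v \<in> ?S \<Longrightarrow> ?f v \<le> ?f b"
    using continuous_attains_sup[OF S cont] by blast
  have sc: "?f v = (norm v)\<^sup>2 * ?f (v /\<^sub>R norm v)" if "v \<noteq> 0" for v
    using that by (simp add: matrix_vector_mult_scaleR field_simps power2_eq_square)
  have "?f a * (norm v)\<^sup>2 \<le> ?f v \<and> ?f v \<le> ?f b * (norm v)\<^sup>2" for v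
  proof (cases "v = 0")
    case False
    then have "v /\<^sub>R norm v \<in> ?S" by simp
    then show ?thesis unfolding sc[OF False] using a(2) b(2)
      by (metis mult.commute mult_left_mono zero_le_power2)
  qed simp
  moreover have "a \<noteq> 0" using a by auto
  then have "?f a > 0" using assms by (auto simp: sym_pos_def_def)
  ultimately show ?thesis
    using assms that[of "?f a" "?f b"] by (auto simp: quad_bounds_def sym_pos_def_def)
qed

section \<open>Sufficient decrease in one iteration\<close>

text \<open>The mean value theorem on the segment replaces the usual integral. It yields
  \<open>L\<close> in place of the sharp \<open>L / 2\<close>, which only changes the constant in
  the step size bound.\<close>

lemma gradient_Lipschitz_upper:
  fixes g :: "'a::real_inner \<Rightarrow> real"
  assumes grad: "\<And>u. GDERIV g u :> G u"
    and lip: "\<And>u v. norm (G u - G v) \<le> L * norm (u - v)"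
    and "0 \<le> \<rho>" "0 \<le> L"
  shows "g (x + \<rho> *\<^sub>R d) \<le> g x + \<rho> * (G x \<bullet> d) + L * \<rho>\<^sup>2 * (norm d)\<^sup>2"
proof (cases "\<rho> = 0")
  case False
  then have \<rho>: "\<rho> > 0" using assms by simp
  have der: "DERIV (\<lambda>t. g (x + t *\<^sub>R d)) t :> d \<bullet> G (x + t *\<^sub>R d)" for t
  proof -
    have "((\<lambda>t. x + t *\<^sub>R d) has_derivative (\<lambda>t. t *\<^sub>R d)) (at t)"
      by (auto intro!: derivative_eq_intros)
    from has_derivative_compose[OF this grad[unfolded gderiv_def]]
    show ?thesis by (simp add: has_field_derivative_def mult_commute_abs)
  qed
  obtain t where t: "0 < t" "t < \<rho>"
    and eq: "g (x + \<rho> *\<^sub>R d) - g (x + 0 *\<^sub>R d) = (\<rho> - 0) * (d \<bullet> G (x + t *\<^sub>R d))"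
    using MVT2[OF \<rho>, of "\<lambda>t. g (x + t *\<^sub>R d)" "\<lambda>t. d \<bullet> G (x + t *\<^sub>R d)"] der by blast
  have "d \<bullet> (G (x + t *\<^sub>R d) - G x) \<le> norm d * (L * norm (t *\<^sub>R d))"
    using lip[of "x + t *\<^sub>R d" x] norm_cauchy_schwarz[of d "G (x + t *\<^sub>R d) - G x"]
    by (smt (verit) add_diff_cancel_left' mult_left_mono norm_ge_zero)
  also have "\<dots> = L * t * (norm d)\<^sup>2" using t by (simp add: power2_eq_square)
  also have "\<dots> \<le> L * \<rho> * (norm d)\<^sup>2"
    using t assms by (intro mult_right_mono mult_left_mono) auto
  finally have "\<rho> * (d \<bullet> G (x + t *\<^sub>R d)) \<le> \<rho> * (d \<bullet> G x + L * \<rho> * (norm d)\<^sup>2)"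
    using \<rho> by (intro mult_left_mono) (auto simp: inner_diff_right)
  then show ?thesis using eq by (simp add: inner_commute power2_eq_square algebra_simps)
qed simp

lemma convex_ereal_combination:
  assumes "convex_ereal h" "h a = ereal \<alpha>" "h b = ereal \<beta>" "0 \<le> t" "t \<le> 1"
  shows "h ((1 - t) *\<^sub>R a + t *\<^sub>R b) \<le> ereal ((1 - t) * \<alpha> + t * \<beta>)"
proof -
  have "(1 - t) *\<^sub>R (a, \<alpha>) + t *\<^sub>R (b, \<beta>) \<in> {(x, t::real). h x \<le> ereal t}"
    using assms unfolding convex_ereal_def by (intro convexD) auto
  then show ?thesis by simp
qed

text \<open>A rejected \<open>\<rho>\<close> exceeds \<open>\<rho>0\<close>, and one reduction costs
  at most the factor \<open>b\<close>, so the lower bound \<open>min 1 (b * \<rho>0)\<close> is an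
  invariant of the search; the \<open>1\<close> covers acceptance of the initial trial.\<close>

lemma backtrack_result:
  assumes "backtrack P b c \<rho> \<eta>" and b: "0 < b" and c: "c < 1"
    and P: "\<And>\<rho>. 0 < \<rho> \<Longrightarrow> \<rho> \<le> 1 \<Longrightarrow> \<rho> \<le> \<rho>0 \<Longrightarrow> P \<rho>"
    and \<rho>: "0 < \<rho>" "\<rho> \<le> 1" "min 1 (b * \<rho>0) \<le> \<rho>"
  shows "P \<eta> \<and> 0 < \<eta> \<and> \<eta> \<le> 1 \<and> min 1 (b * \<rho>0) \<le> \<eta>"
  using assms(1) \<rho>
proof (induction rule: backtrack.induct)
  case (accept \<rho>)
  then show ?case by simp
next
  case (reduce \<rho> \<beta> \<eta>)
  have \<rho>0: "\<rho>0 < \<rho>" using P reduce by force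
  have "0 < \<beta> * \<rho>" using reduce b by simp
  moreover have "\<beta> * \<rho> \<le> 1" using reduce b c by (intro mult_le_one) auto
  moreover have "b * \<rho>0 \<le> \<beta> * \<rho>"
  proof -
    have "b * \<rho>0 \<le> b * \<rho>" using \<rho>0 b by simp
    also have "\<dots> \<le> \<beta> * \<rho>" using reduce by (intro mult_right_mono) auto
    finally show ?thesis .
  qed
  ultimately show ?case using reduce.IH by auto
qed

lemma subdifferential_real:
  "\<xi> \<in> subdifferential (\<lambda>y. ereal (h y)) x \<longleftrightarrow> (\<forall>y. h x + \<xi> \<bullet> (y - x) \<le> h y)"
  by (simp add: subdifferential_def)

text \<open>This collects all that the convergence proof uses about an iteration. The test holds
  once the quadratic error \<open>L * \<rho>\<^sup>2 * (norm d)\<^sup>2\<close> is at most the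
  fraction \<open>1 - \<delta>\<close> of the predicted decrease \<open>- \<rho> * \<Delta>\<close>.
  As \<open>- \<Delta>\<close> is at least \<open>\<theta>bar * m * (norm d)\<^sup>2\<close>, this
  is so for \<open>\<rho> \<le> (1 - \<delta>) * \<theta>bar * m / L\<close>, whence
  \<open>\<eta>lo\<close>.\<close>

lemma dc_newton_step_decrease:
  fixes g :: "real^'n \<Rightarrow> real"
  assumes grad: "\<And>u. GDERIV g u :> G u" and L: "L > 0"
    and lip: "\<And>u v. norm (G u - G v) \<le> L * norm (u - v)"
    and h1: "proper_fun h1" "convex_ereal h1"
    and \<delta>: "0 < \<delta>" "\<delta> < 1" and \<theta>: "0 < \<theta>bar" and \<beta>: "0 < \<beta>min" "\<beta>max < 1"
    and B: "quad_bounds m M B" "m > 0"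
    and x: "h1 x < \<infinity>"
    and step: "dc_newton_step g G h1 h2 \<delta> \<theta>bar \<beta>min \<beta>max B x d x'"
  defines "\<eta>lo \<equiv> min 1 (\<beta>min * ((1 - \<delta>) * \<theta>bar * m / L))"
  obtains \<eta> \<xi> u where "x' = x + \<eta> *\<^sub>R d" "\<eta> > 0"
    and "\<xi> \<in> subdifferential (\<lambda>y. ereal (h2 y)) x" "u \<in> subdifferential h1 (x + d)"
    and "norm (G x - \<xi> + B *v d + u) \<le> M * norm d"
    and "h1 x' < \<infinity>"
    and "real_of_ereal (dc_obj g h1 h2 x') \<le>
      real_of_ereal (dc_obj g h1 h2 x) - \<delta> * \<eta>lo * \<theta>bar * m * (norm d)\<^sup>2"
proof -
  let ?f = "dc_obj g h1 h2"
  obtain \<xi> \<theta> xp r \<eta> u where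
    \<xi>: "\<xi> \<in> subdifferential (\<lambda>y. ereal (h2 y)) x" and \<theta>k: "\<theta>bar \<le> \<theta>" "\<theta> \<le> 1"
    and r: "r = G x - \<xi> + B *v (xp - x) + u" and u: "u \<in> subdifferential h1 xp"
    and rn: "matrix_norm_vec (matrix_inv B) r \<le> (1 - \<theta>) * matrix_norm_vec B (xp - x)"
    and d: "d = xp - x"
    and bt: "backtrack (\<lambda>\<rho>. ?f (x + \<rho> *\<^sub>R d)
                \<le> ?f x + ereal (\<delta> * \<rho>) * (ereal ((G x - \<xi>) \<bullet> d) + h1 xp - h1 x))
          \<beta>min \<beta>max 1 \<eta>" (is "backtrack ?P _ _ _ _")
    and x': "x' = x + \<eta> *\<^sub>R d"
    using step unfolding dc_newton_step_def by blast
  have noninf: "h1 y \<noteq> -\<infinity>" for y using h1 by (simp add: proper_fun_def)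
  obtain a where a: "h1 x = ereal a" using x noninf[of x] by (cases "h1 x") auto
  obtain b where b: "h1 xp = ereal b" using u by (cases "h1 xp") (auto simp: subdifferential_def)
  define \<Delta> where "\<Delta> = (G x - \<xi>) \<bullet> d + b - a"
  define q where "q = d \<bullet> (B *v d)"
  have q: "m * (norm d)\<^sup>2 \<le> q" using B by (simp add: quad_bounds_def q_def)
  have q0: "q \<ge> 0" using q B(2) by (smt (verit) mult_nonneg_nonneg zero_le_power2)
  have r': "r \<bullet> d \<le> (1 - \<theta>) * q" "norm r \<le> M * norm d"
    using quad_bounds_residual[OF B rn] \<theta>k \<theta> by (auto simp: d q_def)
  have "b + u \<bullet> (x - xp) \<le> a"
    using u by (auto simp: subdifferential_def a b dest: spec[of _ x])
  then have "b - u \<bullet> d \<le> a" by (simp add: d inner_diff_right)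
  then have "\<Delta> \<le> (G x - \<xi>) \<bullet> d + u \<bullet> d" by (simp add: \<Delta>_def)
  also have "\<dots> = r \<bullet> d - q"
    by (simp add: r q_def inner_add_left inner_diff_left inner_commute[of "B *v d"] flip: d)
  also have "\<dots> \<le> - \<theta> * q" using r' by (simp add: algebra_simps)
  also have "\<dots> \<le> - \<theta>bar * q" using \<theta>k q0 by (simp add: mult_right_mono)
  also have "\<dots> \<le> - \<theta>bar * (m * (norm d)\<^sup>2)" using q \<theta> by simp
  finally have \<Delta>: "\<Delta> \<le> - \<theta>bar * (m * (norm d)\<^sup>2)" .
  have P_iff: "?P \<rho> \<longleftrightarrow> ?f (x + \<rho> *\<^sub>R d) \<le> ereal (g x + a - h2 x + \<delta> * \<rho> * \<Delta>)" for \<rho>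
    by (simp add: \<Delta>_def dc_obj_def a b)
  have P: "?P \<rho>" if \<rho>: "0 < \<rho>" "\<rho> \<le> 1" "\<rho> \<le> (1 - \<delta>) * \<theta>bar * m / L" for \<rho>
  proof -
    have "x + \<rho> *\<^sub>R d = (1 - \<rho>) *\<^sub>R x + \<rho> *\<^sub>R xp" by (simp add: d algebra_simps)
    then have "h1 (x + \<rho> *\<^sub>R d) \<le> ereal ((1 - \<rho>) * a + \<rho> * b)"
      using convex_ereal_combination[OF h1(2) a b, of \<rho>] \<rho> by simp
    then obtain c where c: "h1 (x + \<rho> *\<^sub>R d) = ereal c" "c \<le> (1 - \<rho>) * a + \<rho> * b"
      using noninf[of "x + \<rho> *\<^sub>R d"] by (cases "h1 (x + \<rho> *\<^sub>R d)") auto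
    \<comment> \<open>The concave part \<open>- h2\<close> lies below its linearization, so it
      contributes no error term.\<close>
    have h2: "h2 x + \<rho> * (\<xi> \<bullet> d) \<le> h2 (x + \<rho> *\<^sub>R d)"
      using \<xi> unfolding subdifferential_real by (metis add_diff_cancel_left' inner_scaleR_right)
    have g: "g (x + \<rho> *\<^sub>R d) \<le> g x + \<rho> * (G x \<bullet> d) + L * \<rho>\<^sup>2 * (norm d)\<^sup>2"
      using \<rho> L by (intro gradient_Lipschitz_upper[OF grad lip]) auto
    have "g (x + \<rho> *\<^sub>R d) + c - h2 (x + \<rho> *\<^sub>R d)
        \<le> g x + a - h2 x + \<rho> * \<Delta> + L * \<rho>\<^sup>2 * (norm d)\<^sup>2"
      using c(2) h2 g by (simp add: \<Delta>_def inner_diff_left algebra_simps)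
    also have "L * \<rho>\<^sup>2 * (norm d)\<^sup>2 = \<rho> * ((L * \<rho>) * (norm d)\<^sup>2)" by (simp add: power2_eq_square)
    also have "\<dots> \<le> \<rho> * (((1 - \<delta>) * \<theta>bar * m) * (norm d)\<^sup>2)"
      using \<rho> L by (intro mult_left_mono mult_right_mono) (auto simp: field_simps)
    also have "\<dots> \<le> \<rho> * ((1 - \<delta>) * - \<Delta>)"
    proof (rule mult_left_mono)
      have "(1 - \<delta>) * (\<theta>bar * (m * (norm d)\<^sup>2)) \<le> (1 - \<delta>) * - \<Delta>"
        using \<delta> \<Delta> by (intro mult_left_mono) auto
      then show "(1 - \<delta>) * \<theta>bar * m * (norm d)\<^sup>2 \<le> (1 - \<delta>) * - \<Delta>" by (simp add: mult.assoc)
    qed (use \<rho> in simp)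
    finally have "g (x + \<rho> *\<^sub>R d) + c - h2 (x + \<rho> *\<^sub>R d) \<le> g x + a - h2 x + \<delta> * \<rho> * \<Delta>"
      by (simp add: algebra_simps)
    then show ?thesis unfolding P_iff by (simp add: dc_obj_def c)
  qed
  have "?P \<eta> \<and> 0 < \<eta> \<and> \<eta> \<le> 1 \<and> min 1 (\<beta>min * ((1 - \<delta>) * \<theta>bar * m / L)) \<le> \<eta>"
    by (rule backtrack_result[OF bt \<beta> P]) auto
  then have \<eta>: "?f x' \<le> ereal (g x + a - h2 x + \<delta> * \<eta> * \<Delta>)" "0 < \<eta>" "\<eta>lo \<le> \<eta>"
    unfolding P_iff by (auto simp: \<eta>lo_def x')
  \<comment> \<open>The right-hand side of the accepted test is real, so acceptance forces
    \<open>x'\<close> into the domain of \<open>h1\<close>.\<close>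
  obtain a' where a': "h1 x' = ereal a'"
    using \<eta>(1) noninf[of x'] by (cases "h1 x'") (auto simp: dc_obj_def)
  have "\<delta> * \<eta> * \<Delta> \<le> \<delta> * \<eta> * (- \<theta>bar * (m * (norm d)\<^sup>2))"
    using \<Delta> \<delta> \<eta> by (intro mult_left_mono) auto
  also have "\<dots> = - (\<delta> * \<eta> * (\<theta>bar * m * (norm d)\<^sup>2))" by simp
  also have "\<dots> \<le> - (\<delta> * \<eta>lo * (\<theta>bar * m * (norm d)\<^sup>2))"
    using \<eta>(3) \<delta> \<theta> B(2) by (simp add: mult_left_mono mult_right_mono)
  finally have "\<delta> * \<eta> * \<Delta> \<le> - (\<delta> * \<eta>lo * \<theta>bar * m * (norm d)\<^sup>2)" by (simp add: mult.assoc)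
  then have "real_of_ereal (?f x') \<le> real_of_ereal (?f x) - \<delta> * \<eta>lo * \<theta>bar * m * (norm d)\<^sup>2"
    using \<eta>(1) by (simp add: dc_obj_def a a')
  moreover have "xp = x + d" by (simp add: d)
  ultimately show ?thesis
    using that[of \<eta> \<xi> u] x' \<eta>(2) \<xi> u r r' a' by (simp flip: d)
qed

section \<open>Limits of subgradients and criticality\<close>

lemma lower_semicont_sequentially:
  assumes "lower_semicont h" "X \<longlonglongrightarrow> a" "c < h a"
  shows "\<forall>\<^sub>F n in sequentially. c < h (X n)"
proof -
  have "\<forall>\<^sub>F y in at a. c < h y"
    using assms(1,3) unfolding lower_semicont_def le_Liminf_iff by blast
  \<comment> \<open>\<open>Liminf (at a)\<close> ignores \<open>a\<close> itself;
    \<open>c < h a\<close> fills the gap, so terms with \<open>X n = a\<close> are covered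
    too.\<close>
  then have "\<forall>\<^sub>F y in nhds a. c < h y"
    using assms(3) unfolding eventually_at_filter by (auto elim: eventually_mono)
  then show ?thesis using assms(2) unfolding filterlim_iff by blast
qed

text \<open>If the limiting inequality failed at \<open>y\<close>, some real number would separate
  its two sides. Lower semicontinuity puts \<open>h (X n)\<close> above it eventually, while the
  subgradient inequalities, in the limit, put it at or below the smaller side.\<close>

lemma subdifferential_closed:
  fixes h :: "'a::real_inner \<Rightarrow> ereal"
  assumes "proper_fun h" "lower_semicont h" "X \<longlonglongrightarrow> a" "U \<longlonglongrightarrow> u"
    and U: "\<And>n. U n \<in> subdifferential h (X n)"
  shows "u \<in> subdifferential h a"
proof -
  \<comment> \<open>This arrangement makes sense before \<open>h a\<close> is known to be finite;
    finiteness follows by taking for \<open>y\<close> a point of the domain.\<close>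
  have ineq: "h a \<le> h y - ereal (u \<bullet> (y - a))" for y
  proof (cases "h y = \<infinity>")
    case False
    then obtain b where b: "h y = ereal b"
      using assms(1) by (cases "h y") (auto simp: proper_fun_def)
    show ?thesis
    proof (rule ccontr)
      assume "\<not> ?thesis"
      then have "ereal (b - u \<bullet> (y - a)) < h a" by (simp add: b)
      then obtain c where c: "ereal (b - u \<bullet> (y - a)) < c" "c < h a"
        using dense by blast
      obtain c' where c': "c = ereal c'" using c by (cases c) auto
      have ev: "\<forall>\<^sub>F n in sequentially. ereal c' < h (X n)"
        using lower_semicont_sequentially[OF assms(2,3)] c c' by auto
      have le: "\<forall>\<^sub>F n in sequentially. c' \<le> b - U n \<bullet> (y - X n)"
        using ev
      proof eventually_elim
        case (elim n)
        have "h (X n) + ereal (U n \<bullet> (y - X n)) \<le> ereal b" "\<bar>h (X n)\<bar> \<noteq> \<infinity>"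
          using U[of n] b by (auto simp: subdifferential_def dest: spec[of _ y])
        then show ?case using elim by (cases "h (X n)") auto
      qed
      have "(\<lambda>n. b - U n \<bullet> (y - X n)) \<longlonglongrightarrow> b - u \<bullet> (y - a)"
        by (intro tendsto_intros assms)
      from tendsto_lowerbound[OF this le] have "c' \<le> b - u \<bullet> (y - a)" by simp
      then show False using c c' by simp
    qed
  qed simp
  obtain y0 where "h y0 \<noteq> \<infinity>" using assms(1) by (auto simp: proper_fun_def)
  then have fin: "\<bar>h a\<bar> \<noteq> \<infinity>"
    using ineq[of y0] assms(1) by (cases "h y0"; cases "h a") (auto simp: proper_fun_def)
  moreover have "h a + ereal (u \<bullet> (y - a)) \<le> h y" for y
    using ineq[of y] fin by (cases "h y"; cases "h a") auto
  ultimately show ?thesis by (simp add: subdifferential_def)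
qed

text \<open>Moving from \<open>X n\<close> a unit length in the direction of the subgradient raises
  \<open>h\<close> by at least the norm of the subgradient, while \<open>h\<close> is bounded on the
  slightly larger ball of radius \<open>R + 1\<close>.\<close>

lemma subgradients_bounded:
  fixes h :: "'a::euclidean_space \<Rightarrow> real"
  assumes h: "continuous_on UNIV h" and X: "bounded (range X)"
    and \<Xi>: "\<And>n. \<Xi> n \<in> subdifferential (\<lambda>y. ereal (h y)) (X n)"
  shows "bounded (range \<Xi>)"
proof -
  obtain R where R: "\<And>n. norm (X n) \<le> R" using X by (auto simp: bounded_iff)
  have "compact (h ` cball 0 (R + 1))"
    by (intro compact_continuous_image continuous_on_subset[OF h]) auto
  then have "bounded (h ` cball 0 (R + 1))" by (rule compact_imp_bounded)
  then obtain C where C: "\<And>y. norm y \<le> R + 1 \<Longrightarrow> \<bar>h y\<bar> \<le> C"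
    unfolding bounded_iff by force
  have "norm (\<Xi> n) \<le> 2 * C" for n
  proof -
    define y where "y = X n + sgn (\<Xi> n)"
    have "norm y \<le> R + 1"
      using norm_triangle_ineq[of "X n" "sgn (\<Xi> n)"] R[of n] norm_sgn[of "\<Xi> n"]
      by (auto simp: y_def split: if_splits)
    then have "\<bar>h y\<bar> \<le> C" by (rule C)
    moreover have "\<bar>h (X n)\<bar> \<le> C" using R[of n] by (intro C) simp
    moreover have "h (X n) + \<Xi> n \<bullet> (y - X n) \<le> h y" using \<Xi>[of n] by (simp only: subdifferential_real)
    moreover have "\<Xi> n \<bullet> (y - X n) = norm (\<Xi> n)"
      by (cases "\<Xi> n = 0") (simp_all add: y_def sgn_div_norm power2_eq_square flip: power2_norm_eq_inner)
    ultimately show ?thesis by linarith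
  qed
  then show ?thesis by (auto simp: bounded_iff)
qed

text \<open>A further subsequence is chosen only for \<open>\<xi>\<close>; convergence of
  \<open>u\<close> to \<open>\<xi>' - G a\<close> is then forced by \<open>lim\<close>. As
  \<open>u n\<close> is a subgradient at the shifted point \<open>X n + D n\<close>, the shift has
  to vanish.\<close>

lemma dc_critical_limit:
  fixes G :: "'a::euclidean_space \<Rightarrow> 'a"
  assumes h1: "proper_fun h1" "lower_semicont h1" and h2: "continuous_on UNIV h2"
    and G: "continuous_on UNIV G"
    and X: "X \<longlonglongrightarrow> a" and D: "D \<longlonglongrightarrow> 0"
    and \<xi>: "\<And>n. \<xi> n \<in> subdifferential (\<lambda>y. ereal (h2 y)) (X n)"
    and u: "\<And>n. u n \<in> subdifferential h1 (X n + D n)"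
    and lim: "(\<lambda>n. G (X n) - \<xi> n + u n) \<longlonglongrightarrow> 0"
  shows "dc_critical G h1 h2 a"
proof -
  have "bounded (range \<xi>)"
    by (rule subgradients_bounded[OF h2 convergent_imp_bounded[OF X] \<xi>])
  then obtain \<xi>' s where s: "strict_mono (s :: nat \<Rightarrow> nat)" and \<xi>': "(\<xi> \<circ> s) \<longlonglongrightarrow> \<xi>'"
    using bounded_imp_convergent_subsequence[of \<xi>] by (auto simp: o_def)
  note sub = LIMSEQ_subseq_LIMSEQ[OF _ s, unfolded o_def]
  have Xs: "(\<lambda>n. X (s n)) \<longlonglongrightarrow> a" by (rule sub[OF X])
  have \<xi>s: "(\<lambda>n. \<xi> (s n)) \<longlonglongrightarrow> \<xi>'" using \<xi>' by (simp add: o_def)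
  have GX: "(\<lambda>n. G (X (s n))) \<longlonglongrightarrow> G a"
    using G Xs by (metis UNIV_I continuous_on_eq_continuous_at isCont_tendsto_compose open_UNIV)
  have XD: "(\<lambda>n. X (s n) + D (s n)) \<longlonglongrightarrow> a" using tendsto_add[OF Xs sub[OF D]] by simp
  have "(\<lambda>n. (G (X (s n)) - \<xi> (s n) + u (s n)) - G (X (s n)) + \<xi> (s n)) \<longlonglongrightarrow> 0 - G a + \<xi>'"
    by (intro tendsto_add tendsto_diff sub[OF lim] GX \<xi>s)
  then have us: "(\<lambda>n. u (s n)) \<longlonglongrightarrow> \<xi>' - G a" by simp
  have "\<xi>' - G a \<in> subdifferential h1 a"
    by (rule subdifferential_closed[OF h1 XD us u])
  moreover have "\<xi>' \<in> subdifferential (\<lambda>y. ereal (h2 y)) a"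
  proof (rule subdifferential_closed[OF _ _ Xs \<xi>s \<xi>])
    show "proper_fun (\<lambda>y. ereal (h2 y))" by (simp add: proper_fun_def)
    have "((\<lambda>y. ereal (h2 y)) \<longlongrightarrow> ereal (h2 x)) (at x)" for x
      using h2 by (simp add: continuous_on_def)
    then show "lower_semicont (\<lambda>y. ereal (h2 y))"
      unfolding lower_semicont_def
      by (metis lim_imp_Liminf order_refl trivial_limit_at)
  qed
  moreover have "0 = G a + (\<xi>' - G a) - \<xi>'" by simp
  ultimately show ?thesis unfolding dc_critical_def by blast
qed

section \<open>Convergence of the method\<close>

theorem theorem4:
  fixes g :: "real^'n \<Rightarrow> real" and G :: "real^'n \<Rightarrow> real^'n"
    and h1 :: "real^'n \<Rightarrow> ereal" and h2 :: "real^'n \<Rightarrow> real"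
    and x d s z :: "nat \<Rightarrow> real^'n" and B :: "nat \<Rightarrow> real^'n^'n"
    and \<nu> \<phi> \<gamma> \<tau> :: "nat \<Rightarrow> real"
    and L \<delta> \<theta>bar \<beta>min \<beta>max \<nu>lo \<nu>hi \<phi>1 \<phi>2 \<gamma>lo \<gamma>hi \<tau>lo \<tau>hi :: real
  assumes g_grad: "\<And>u. GDERIV g u :> G u"
    and G_cont: "continuous_on UNIV G"
    and L_pos: "L > 0"
    and G_lip: "\<And>u v. norm (G u - G v) \<le> L * norm (u - v)"
    and h1: "proper_fun h1" "lower_semicont h1" "convex_ereal h1"
    and h2: "continuous_on UNIV h2" "convex_on UNIV h2"
    and \<delta>: "0 < \<delta>" "\<delta> < 1"
    and \<theta>bar: "0 < \<theta>bar" "\<theta>bar \<le> 1"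
    and \<beta>: "0 < \<beta>min" "\<beta>min \<le> \<beta>max" "\<beta>max < 1"
    and x0_dom: "dc_obj g h1 h2 (x 0) < \<infinity>"
    and step: "\<And>k. dc_newton_step g G h1 h2 \<delta> \<theta>bar \<beta>min \<beta>max (B k) (x k) (d k) (x (Suc k))"
    and s_def: "\<And>k. k \<ge> 1 \<Longrightarrow> s (k - 1) = x k - x (k - 1)"
    and z_def: "\<And>k. k \<ge> 1 \<Longrightarrow> z (k - 1) = G (x k) - G (x (k - 1)) + \<nu> k *\<^sub>R s (k - 1)"
    and B0: "sym_pos_def (B 0)"
    and Bk: "\<And>k. k \<ge> 1 \<Longrightarrow> B k = memoryless_matrix (\<tau> k) (\<gamma> k) (\<phi> k) (s (k - 1)) (z (k - 1))"
    and d_nz: "\<And>k. d k \<noteq> 0"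
    and bounds: "\<nu>lo > 0" "\<nu>hi > 0" "0 \<le> \<phi>1" "\<phi>1 < 1" "\<phi>2 > 0"
      "0 < \<gamma>lo" "\<gamma>lo \<le> \<gamma>hi" "0 < \<tau>lo" "\<tau>lo \<le> \<tau>hi"
    and \<nu>_bd: "\<And>k. k \<ge> 1 \<Longrightarrow> 0 \<le> \<nu> k \<and> \<nu> k \<le> \<nu>hi"
    and sz_bd: "\<And>k. k \<ge> 1 \<Longrightarrow> s (k - 1) \<bullet> z (k - 1) \<ge> \<nu>lo * (norm (s (k - 1)))\<^sup>2"
    and \<phi>_lower: "\<And>k. k \<ge> 1 \<Longrightarrow> phi_denom (s (k - 1)) (z (k - 1)) \<noteq> 0 \<Longrightarrow>
      \<phi>1 * phi_star (s (k - 1)) (z (k - 1)) \<le> \<phi> k"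
    and \<phi>_upper: "\<And>k. k \<ge> 1 \<Longrightarrow> \<phi> k \<le> \<phi>2"
    and \<gamma>_bd: "\<And>k. k \<ge> 1 \<Longrightarrow> \<gamma>lo \<le> \<gamma> k \<and> \<gamma> k \<le> \<gamma>hi"
    and \<tau>_bd: "\<And>k. k \<ge> 1 \<Longrightarrow> \<tau>lo \<le> \<tau> k \<and> \<tau> k \<le> \<tau>hi"
    and f_bdd_below: "\<exists>M::real. \<forall>y. ereal M \<le> dc_obj g h1 h2 y"
  shows "(\<lambda>k. norm (d k)) \<longlonglongrightarrow> 0 \<and>
    (bounded (range x) \<longrightarrow>
      (\<forall>xs. (\<exists>r :: nat \<Rightarrow> nat. strict_mono r \<and> (x \<circ> r) \<longlonglongrightarrow> xs) \<longrightarrow> dc_critical G h1 h2 xs))"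
proof -
  let ?f = "\<lambda>k. real_of_ereal (dc_obj g h1 h2 (x k))"
  obtain m0 M0 where B0': "m0 > 0" "quad_bounds m0 M0 (B 0)"
    by (rule sym_pos_def_quad_bounds[OF B0])
  \<comment> \<open>\<open>K\<close> bounds the ratio of \<open>norm (z k)\<close> to
    \<open>norm (s k)\<close>. \<open>m1\<close> and \<open>M1\<close> are the constants of the two
    memoryless bounds, and \<open>m\<close> and \<open>M\<close> also cover the initial
    matrix.\<close>
  define K where "K = L + \<nu>hi"
  define m1 where "m1 = 1 / (2 / (\<gamma>lo * \<nu>lo) + (2 * (K / \<nu>lo)\<^sup>2 + 1) / (\<tau>lo * (1 - \<phi>1)))"
  define M1 where "M1 = \<tau>hi + \<gamma>hi * K\<^sup>2 / \<nu>lo + \<tau>hi * \<phi>2 * (K / \<nu>lo)\<^sup>2"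
  define m where "m = min m0 m1"
  define M where "M = max M0 M1"
  have m1: "m1 > 0"
    unfolding m1_def using bounds by (intro divide_pos_pos add_pos_pos mult_pos_pos add_nonneg_pos) auto
  then have m: "m > 0" using B0' by (simp add: m_def)
  have h1_step: "h1 (x k) < \<infinity> \<Longrightarrow> quad_bounds m M (B k) \<Longrightarrow> h1 (x (Suc k)) < \<infinity> \<and>
      (\<exists>\<eta>>0. x (Suc k) = x k + \<eta> *\<^sub>R d k)" for k
    using dc_newton_step_decrease[OF g_grad L_pos G_lip h1(1,3) \<delta> \<theta>bar(1) \<beta>(1,3) _ m _ step[of k]]
    by (metis (no_types))
  \<comment> \<open>The two claims need a joint induction: the bounds on \<open>B (Suc k)\<close>
    require \<open>s k \<noteq> 0\<close>, hence a positive step size at \<open>k\<close>, which in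
    turn rests on the bounds on \<open>B k\<close> and on \<open>x k\<close> lying in the domain of
    \<open>h1\<close>.\<close>
  have inv: "h1 (x k) < \<infinity> \<and> quad_bounds m M (B k)" for k
  proof (induction k)
    case 0
    have "h1 (x 0) < \<infinity>" using x0_dom by (cases "h1 (x 0)") (auto simp: dc_obj_def)
    moreover have "quad_bounds m M (B 0)"
      by (rule quad_bounds_mono[OF B0'(2)]) (auto simp: m_def M_def)
    ultimately show ?case by simp
  next
    case (Suc k)
    obtain \<eta> where \<eta>: "\<eta> > 0" "x (Suc k) = x k + \<eta> *\<^sub>R d k" using h1_step Suc by blast
    have s: "s k = x (Suc k) - x k" using s_def[of "Suc k"] by simp
    then have s0: "s k \<noteq> 0" using \<eta> d_nz by simp
    have "z k = G (x (Suc k)) - G (x k) + \<nu> (Suc k) *\<^sub>R s k" using z_def[of "Suc k"] by simp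
    then have "norm (z k) \<le> norm (G (x (Suc k)) - G (x k)) + norm (\<nu> (Suc k) *\<^sub>R s k)"
      using norm_triangle_ineq by metis
    also have "\<dots> \<le> L * norm (s k) + \<nu>hi * norm (s k)"
      using G_lip[of "x (Suc k)" "x k"] \<nu>_bd[of "Suc k"] by (intro add_mono) (auto simp: s mult_right_mono)
    finally have zK: "norm (z k) \<le> K * norm (s k)" by (simp add: K_def distrib_right)
    have sz: "s k \<bullet> z k \<ge> \<nu>lo * (norm (s k))\<^sup>2" using sz_bd[of "Suc k"] by simp
    have \<phi>: "phi_denom (s k) (z k) \<noteq> 0 \<Longrightarrow> \<phi>1 * phi_star (s k) (z k) \<le> \<phi> (Suc k)"
      using \<phi>_lower[of "Suc k"] by simp
    have par: "\<gamma>lo \<le> \<gamma> (Suc k)" "\<gamma> (Suc k) \<le> \<gamma>hi" "\<tau>lo \<le> \<tau> (Suc k)" "\<tau> (Suc k) \<le> \<tau>hi" "\<phi> (Suc k) \<le> \<phi>2"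
      using \<gamma>_bd[of "Suc k"] \<tau>_bd[of "Suc k"] \<phi>_upper[of "Suc k"] by auto
    have BS: "B (Suc k) = memoryless_matrix (\<tau> (Suc k)) (\<gamma> (Suc k)) (\<phi> (Suc k)) (s k) (z k)"
      using Bk[of "Suc k"] by simp
    have up: "v \<bullet> (B (Suc k) *v v) \<le> M1 * (norm v)\<^sup>2" for v
      unfolding BS M1_def
      by (rule memoryless_matrix_upper[OF s0 bounds(1) sz zK]) (use par bounds in auto)
    have "(norm v)\<^sup>2 \<le> (1 / m1) * (v \<bullet> (B (Suc k) *v v))" for v
      unfolding BS m1_def
      using memoryless_matrix_lower[OF s0 bounds(1) sz zK bounds(6) par(1) bounds(8) par(3) bounds(3,4) \<phi>, of v]
      by simp
    then have "m1 * (norm v)\<^sup>2 \<le> v \<bullet> (B (Suc k) *v v)" for v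
      using m1 by (simp add: field_simps)
    then have "quad_bounds m1 M1 (B (Suc k))"
      using up unfolding quad_bounds_def by (simp add: BS transpose_memoryless_matrix)
    then have "quad_bounds m M (B (Suc k))"
      by (rule quad_bounds_mono) (auto simp: m_def M_def)
    then show ?case using h1_step Suc by blast
  qed
  define c where "c = \<delta> * min 1 (\<beta>min * ((1 - \<delta>) * \<theta>bar * m / L)) * \<theta>bar * m"
  have c: "c > 0"
    unfolding c_def using \<delta> \<beta>(1) \<theta>bar m L_pos by (intro mult_pos_pos) auto
  have "\<exists>\<xi> u. \<xi> \<in> subdifferential (\<lambda>y. ereal (h2 y)) (x k) \<and> u \<in> subdifferential h1 (x k + d k) \<and>
      norm (G (x k) - \<xi> + B k *v d k + u) \<le> M * norm (d k) \<and> ?f (Suc k) \<le> ?f k - c * (norm (d k))\<^sup>2" for k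
    using dc_newton_step_decrease[OF g_grad L_pos G_lip h1(1,3) \<delta> \<theta>bar(1) \<beta>(1,3) _ m _ step[of k]] inv[of k]
    unfolding c_def by (metis (no_types))
  then obtain \<xi> u where
    \<xi>: "\<And>k. \<xi> k \<in> subdifferential (\<lambda>y. ereal (h2 y)) (x k)" and
    u: "\<And>k. u k \<in> subdifferential h1 (x k + d k)" and
    res: "\<And>k. norm (G (x k) - \<xi> k + B k *v d k + u k) \<le> M * norm (d k)" and
    dec: "\<And>k. ?f (Suc k) \<le> ?f k - c * (norm (d k))\<^sup>2"
    by metis
  obtain F where F: "\<And>y. ereal F \<le> dc_obj g h1 h2 y" using f_bdd_below by blast
  have "F \<le> ?f k" for k
  proof -
    have "h1 (x k) \<noteq> \<infinity>" using inv[of k] by simp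
    moreover have "h1 (x k) \<noteq> -\<infinity>" using h1(1) by (simp add: proper_fun_def)
    ultimately show ?thesis using F[of "x k"] by (cases "h1 (x k)") (auto simp: dc_obj_def)
  qed
  moreover have "decseq ?f"
    using dec c by (intro decseq_SucI) (smt (verit) mult_nonneg_nonneg zero_le_power2)
  ultimately obtain l where l: "?f \<longlonglongrightarrow> l" using decseq_convergent by blast
  \<comment> \<open>The objective values decrease and are bounded below, so their successive
    differences vanish; divided by \<open>c\<close> they dominate
    \<open>(norm (d k))\<^sup>2\<close>.\<close>
  have "(\<lambda>k. (?f k - ?f (Suc k)) / c) \<longlonglongrightarrow> (l - l) / c"
    using c by (intro tendsto_intros l LIMSEQ_Suc[OF l]) auto
  then have lim: "(\<lambda>k. (?f k - ?f (Suc k)) / c) \<longlonglongrightarrow> 0" by simp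
  have "(norm (d k))\<^sup>2 \<le> (?f k - ?f (Suc k)) / c" for k
    using dec[of k] c by (simp add: field_simps)
  then have "(\<lambda>k. (norm (d k))\<^sup>2) \<longlonglongrightarrow> 0"
    by (intro tendsto_sandwich[OF _ _ tendsto_const lim]) auto
  then have "(\<lambda>k. sqrt ((norm (d k))\<^sup>2)) \<longlonglongrightarrow> sqrt 0" by (rule tendsto_real_sqrt)
  then have nd: "(\<lambda>k. norm (d k)) \<longlonglongrightarrow> 0" by simp
  then have d0: "d \<longlonglongrightarrow> 0" by (rule tendsto_norm_zero_cancel)
  \<comment> \<open>One \<open>M\<close> comes from the residual, the other from moving
    \<open>B k *v d k\<close> out of it.\<close>
  have bnd: "norm (G (x k) - \<xi> k + u k) \<le> (M + M) * norm (d k)" for k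
  proof -
    have "norm (B k *v d k) \<le> M * norm (d k)" using inv[of k] quad_bounds_norm_mult m by blast
    then show ?thesis
      using res[of k] norm_triangle_ineq4[of "G (x k) - \<xi> k + B k *v d k + u k" "B k *v d k"]
      by (simp add: algebra_simps)
  qed
  have "(\<lambda>k. (M + M) * norm (d k)) \<longlonglongrightarrow> 0" using tendsto_mult_left[OF nd, of "M + M"] by simp
  then have r0: "(\<lambda>k. G (x k) - \<xi> k + u k) \<longlonglongrightarrow> 0"
    by (rule Lim_null_comparison[rotated]) (intro always_eventually allI bnd)
  have "dc_critical G h1 h2 xs" if "strict_mono r" "(x \<circ> r) \<longlonglongrightarrow> xs" for xs and r :: "nat \<Rightarrow> nat"
  proof -
    note sub = LIMSEQ_subseq_LIMSEQ[OF _ that(1), unfolded o_def]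
    show ?thesis
      by (rule dc_critical_limit[OF h1(1,2) h2(1) G_cont that(2)[unfolded o_def] sub[OF d0] \<xi> u sub[OF r0]])
  qed
  then show ?thesis using nd by blast
qed

end
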